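(* Let $n\ge 2$, let $\alpha_1^0,\dots,\alpha_n^0$ be distinct complex numbers and $m_1^0,\dots,m_n^0$ complex numbers, put $\phi(z)=\prod_{i=1}^n(z-\alpha_i^0)$ and $f(z)=\sum_{i=1}^n m_i^0\prod_{j\neq i}(z-\alpha_j^0)$, and consider the isofocal dynamics $$F_t(z)=\sum_{i=1}^n\frac{m_i(t)}{z-\alpha_i(t)}=\frac{f(z)}{\phi(z)+tf(z)},\qquad m_i(0)=m_i^0,\ \alpha_i(0)=\alpha_i^0 .$$ Assume that the initial data are such that the Flaschka coordinates $(a_1,\dots,a_{n-1},b_1,\dots,b_n)$ of $F_t$ are defined. Then in the Flaschka coordinates the dynamical system takes the trivial form $$\dot a_1=\dot a_2=\dots=\dot a_{n-1}=0,\qquad \dot b_1=\dot b_2=\dots=\dot b_{n-1}=0,\qquad \dot b_n=-1,$$ where the dot denotes the derivative with respect to $t$.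
   Context: The Flaschka coordinates of the rational function $F_t$ are the quantities $a_1,\dots,a_{n-1}$ (nonzero) and $b_1,\dots,b_n$ in the continued fraction expansion $$F_t(z)=\cfrac{1}{z-b_n-\cfrac{a_{n-1}^2}{z-b_{n-1}-\cfrac{a_{n-2}^2}{z-b_{n-2}-\dots-\cfrac{a_1^2}{z-b_1}}}} .$$ They are defined when $F_t$ admits such an expansion (in particular the leading coefficient $\sum_i m_i^0$ of $f$ is then $1$). The $a_i$ are determined up to sign and are chosen to depend continuously on $t$. *)

theory Defs
  imports "HOL-Analysis.Analysis" "HOL-Computational_Algebra.Polynomial_Factorial"
begin

text \<open>
  Rational functions of \<open>z\<close> are elements of the field \<open>complex poly fract\<close>, so an equation
  between them is an identity in the field of rational functions and does not depend on the value
  a function would be given at a pole.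
  All finite families are functions on \<open>nat\<close> of which only the indices \<open>1, \<dots>, n\<close>
  (for the \<open>a\<^sub>i\<close>: \<open>1, \<dots>, n - 1\<close>) matter.
\<close>

definition ratvar :: "complex poly fract" where
  "ratvar = to_fract [:0, 1:]"

definition ratconst :: "complex \<Rightarrow> complex poly fract" where
  "ratconst c = to_fract [:c:]"

definition phi_poly :: "nat \<Rightarrow> (nat \<Rightarrow> complex) \<Rightarrow> complex poly" where
  "phi_poly n \<alpha> = (\<Prod>i\<in>{1..n}. [:- \<alpha> i, 1:])"

definition f_poly :: "nat \<Rightarrow> (nat \<Rightarrow> complex) \<Rightarrow> (nat \<Rightarrow> complex) \<Rightarrow> complex poly" where
  "f_poly n m \<alpha> = (\<Sum>i\<in>{1..n}. smult (m i) (\<Prod>j\<in>{1..n} - {i}. [:- \<alpha> j, 1:]))"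

definition partial_fractions ::
    "nat \<Rightarrow> (nat \<Rightarrow> complex) \<Rightarrow> (nat \<Rightarrow> complex) \<Rightarrow> complex poly fract" where
  "partial_fractions n m \<alpha> = (\<Sum>i\<in>{1..n}. ratconst (m i) / (ratvar - ratconst (\<alpha> i)))"

text \<open>
  \<open>cfrac a b k\<close> is the inner fraction \<open>1 / (z - b\<^sub>k - a\<^sub>k\<^sub>-\<^sub>1\<^sup>2 / (\<dots> - a\<^sub>1\<^sup>2 / (z - b\<^sub>1)))\<close>, built from the
  innermost level outwards. Since \<open>cfrac a b 0 = 0\<close>, the entry \<open>a 0\<close> plays no role. The denominator
  at every level equals \<open>z\<close> plus a rational function of degree at most 0, hence is
  nonzero, and no division by zero occurs.
\<close>

primrec cfrac :: "(nat \<Rightarrow> complex) \<Rightarrow> (nat \<Rightarrow> complex) \<Rightarrow> nat \<Rightarrow> complex poly fract" where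
  "cfrac a b 0 = 0"
| "cfrac a b (Suc k) =
     1 / (ratvar - ratconst (b (Suc k)) - ratconst ((a k)\<^sup>2) * cfrac a b k)"

definition is_flaschka ::
    "nat \<Rightarrow> complex poly fract \<Rightarrow> (nat \<Rightarrow> complex) \<Rightarrow> (nat \<Rightarrow> complex) \<Rightarrow> bool" where
  "is_flaschka n F a b \<longleftrightarrow> (\<forall>i\<in>{1..n - 1}. a i \<noteq> 0) \<and> F = cfrac a b n"

text \<open>
  Flaschka coordinates along a family \<open>F\<close> over a set \<open>T\<close> of times, the signs of
  the \<open>a\<^sub>i\<close> being chosen so that they depend continuously on \<open>t\<close>.
\<close>

definition is_flaschka_on ::
    "complex set \<Rightarrow> nat \<Rightarrow> (complex \<Rightarrow> complex poly fract) \<Rightarrow>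
     (nat \<Rightarrow> complex \<Rightarrow> complex) \<Rightarrow> (nat \<Rightarrow> complex \<Rightarrow> complex) \<Rightarrow> bool" where
  "is_flaschka_on T n F a b \<longleftrightarrow>
     (\<forall>t\<in>T. is_flaschka n (F t) (\<lambda>i. a i t) (\<lambda>i. b i t)) \<and>
     (\<forall>i\<in>{1..n - 1}. continuous_on T (a i))"

end

theory Submission
  imports Defs
begin

text \<open>
  Passing to reciprocals, \<open>1 / F\<^sub>t = 1 / F\<^sub>0 + t\<close>, and \<open>b\<^sub>n\<close> enters \<open>1 / F\<^sub>t\<close> only as the summand \<open>- b\<^sub>n\<close>.
  Since a continued fraction of this shape determines its \<open>b\<^sub>i\<close> and \<open>a\<^sub>i\<^sup>2\<close>, the flow
  shifts \<open>b\<^sub>n\<close> by \<open>- t\<close> and fixes every other \<open>b\<^sub>i\<close> and every \<open>a\<^sub>i\<^sup>2\<close>. A continuous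
  nonvanishing function with constant square is locally constant, so the \<open>a\<^sub>i\<close> have derivative 0.
\<close>

lemma ratconst_simps [simp]:
  "ratconst 0 = 0"
  "ratconst (x + y) = ratconst x + ratconst y"
  "ratconst (x - y) = ratconst x - ratconst y"
  "ratconst x = ratconst y \<longleftrightarrow> x = y"
  by (simp_all add: ratconst_def flip: to_fract_add to_fract_diff)

text \<open>If the inner fraction is \<open>p / q\<close>, the next level is \<open>q / r\<close>
  with \<open>r = (z - b) * q - a\<^sup>2 * p\<close>, where \<open>z * q\<close> dominates, so
  monicity persists and the degree grows by one. Coprimality is not asserted: leading terms suffice
  below.\<close>

lemma cfrac_quotient_of_monic:
  "\<exists>p q. cfrac a b k = to_fract p / to_fract q \<and> degree q = k \<and> coeff q k = 1 \<and>
     (if k = 0 then p = 0 else degree p = k - 1 \<and> coeff p (k - 1) = 1)"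
proof (induction k)
  case 0
  show ?case by (rule exI[of _ 0], rule exI[of _ 1]) simp
next
  case (Suc k)
  then obtain p q where pq: "cfrac a b k = to_fract p / to_fract q" "degree q = k" "coeff q k = 1"
    and p: "if k = 0 then p = 0 else degree p = k - 1 \<and> coeff p (k - 1) = 1"
    by blast
  define r where "r = [:- b (Suc k), 1:] * q - smult ((a k)\<^sup>2) p"
  have q0: "q \<noteq> 0" using pq(3) by auto
  \<comment> \<open>For \<open>k = 0\<close> the truncated \<open>k - 1\<close> would allow a
    nonzero constant, hence the separate case \<open>p = 0\<close>.\<close>
  have p_high: "coeff p i = 0" if "i \<ge> k" for i
    using p that by (cases "k = 0") (auto intro: coeff_eq_0)
  have q_high: "coeff q i = 0" if "i > k" for i
    using pq(2) that by (auto intro: coeff_eq_0)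
  have r_lead: "coeff r (Suc k) = 1"
    by (simp add: r_def pq p_high q_high)
  have "degree r \<le> Suc k"
    by (rule degree_le) (auto simp: r_def p_high q_high coeff_pCons split: nat.split)
  moreover have "degree r \<ge> Suc k"
    using r_lead by (intro le_degree) simp
  ultimately have r_deg: "degree r = Suc k" by simp
  have "r \<noteq> 0" using r_lead by auto
  have "ratvar - ratconst (b (Suc k)) = to_fract [:- b (Suc k), 1:]"
    by (simp add: ratvar_def ratconst_def flip: to_fract_diff)
  moreover have "ratconst ((a k)\<^sup>2) * to_fract p = to_fract (smult ((a k)\<^sup>2) p)"
    by (simp add: ratconst_def flip: to_fract_mult)
  ultimately have "ratvar - ratconst (b (Suc k)) - ratconst ((a k)\<^sup>2) * cfrac a b k
      = to_fract r / to_fract q"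
    using q0 unfolding pq(1) r_def to_fract_diff to_fract_mult
    by (metis diff_divide_distrib nonzero_mult_div_cancel_right times_divide_eq_right to_fract_eq_0_iff)
  then have "cfrac a b (Suc k) = to_fract q / to_fract r" by simp
  then show ?case using pq r_lead r_deg by auto
qed

lemma cfrac_nonzero:
  assumes "k > 0"
  shows "cfrac a b k \<noteq> 0"
proof -
  obtain p q where "cfrac a b k = to_fract p / to_fract q" "coeff q k = 1" "coeff p (k - 1) = 1"
    using cfrac_quotient_of_monic[of a b k] assms by auto
  then show ?thesis by auto
qed

text \<open>At infinity the fraction behaves like \<open>1 / z\<close>, so \<open>c\<close> is the
  value there and \<open>d\<close> the coefficient of \<open>1 / z\<close>. Both can be read off
  before the two inner fractions are known to agree.\<close>

lemma affine_cfrac_inject: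
  assumes "k > 0"
    and eq: "ratconst c + ratconst d * cfrac a b k = ratconst c' + ratconst d' * cfrac a' b' k"
  shows "c = c'" and "d = d'"
proof -
  obtain p q where pq: "cfrac a b k = to_fract p / to_fract q" "degree q = k" "coeff q k = 1"
    "degree p = k - 1" "coeff p (k - 1) = 1"
    using cfrac_quotient_of_monic[of a b k] \<open>k > 0\<close> by auto
  obtain p' q' where pq': "cfrac a' b' k = to_fract p' / to_fract q'" "degree q' = k"
    "coeff q' k = 1" "degree p' = k - 1" "coeff p' (k - 1) = 1"
    using cfrac_quotient_of_monic[of a' b' k] \<open>k > 0\<close> by auto
  have nz: "q \<noteq> 0" "q' \<noteq> 0" using pq(3) pq'(3) by auto
  have "to_fract (smult c (q * q') + smult d (p * q')) =
        to_fract (smult c' (q * q') + smult d' (p' * q))"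
  proof -
    have s: "to_fract (smult x r) = ratconst x * to_fract r" for x r
      by (simp add: ratconst_def flip: to_fract_mult)
    show ?thesis
      using eq nz unfolding pq(1) pq'(1)
      by (simp add: s to_fract_add to_fract_mult field_simps)
  qed
  then have poly_eq: "smult c (q * q') + smult d (p * q') = smult c' (q * q') + smult d' (p' * q)"
    by (simp only: to_fract_eq_iff)
  have lead: "coeff (q * q') (k + k) = 1"
    using coeff_mult_degree_sum[of q q'] pq pq' by simp
  have low: "coeff (p * q') (k - 1 + k) = 1" "coeff (p' * q) (k - 1 + k) = 1"
    using coeff_mult_degree_sum[of p q'] coeff_mult_degree_sum[of p' q] pq pq' by simp_all
  \<comment> \<open>\<open>k > 0\<close> puts the degree \<open>k - 1 + k\<close> of these products
    strictly below \<open>k + k\<close>.\<close>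
  have zero: "coeff (p * q') (k + k) = 0" "coeff (p' * q) (k + k) = 0"
    using degree_mult_le[of p q'] degree_mult_le[of p' q] pq pq' \<open>k > 0\<close>
    by (auto intro!: coeff_eq_0)
  show c: "c = c'"
    using arg_cong[OF poly_eq, of "\<lambda>r. coeff r (k + k)"] lead zero by simp
  \<comment> \<open>The coefficient of \<open>q * q'\<close> in degree \<open>k - 1 + k\<close> is
    unknown, but it cancels because \<open>c = c'\<close>.\<close>
  show "d = d'"
    using arg_cong[OF poly_eq, of "\<lambda>r. coeff r (k - 1 + k)"] low c by simp
qed

text \<open>Reciprocals expose the outermost level as an affine expression in the inner fraction,
  whose two coefficients are determined. Dividing by the nonzero \<open>(a k)\<^sup>2\<close> then
  equates the inner fractions.\<close>

lemma cfrac_inject: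
  assumes "cfrac a b k = cfrac a' b' k"
    and "\<And>i. i \<in> {1..<k} \<Longrightarrow> a i \<noteq> 0"
  shows "(\<forall>i\<in>{1..k}. b i = b' i) \<and> (\<forall>i\<in>{1..<k}. (a i)\<^sup>2 = (a' i)\<^sup>2)"
  using assms
proof (induction k)
  case 0
  then show ?case by simp
next
  case (Suc k)
  have eq: "ratconst (b (Suc k)) + ratconst ((a k)\<^sup>2) * cfrac a b k =
      ratconst (b' (Suc k)) + ratconst ((a' k)\<^sup>2) * cfrac a' b' k"
    using Suc.prems(1) by (simp add: divide_inverse algebra_simps)
  show ?case
  proof (cases "k = 0")
    case True
    then show ?thesis using eq by auto
  next
    case False
    note coeffs = affine_cfrac_inject[OF _ eq]
    have "ratconst ((a k)\<^sup>2) \<noteq> 0"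
      using Suc.prems(2)[of k] False ratconst_simps(4)[of "(a k)\<^sup>2" 0] by simp
    then have "cfrac a b k = cfrac a' b' k"
      using eq coeffs False by simp
    then have "(\<forall>i\<in>{1..k}. b i = b' i) \<and> (\<forall>i\<in>{1..<k}. (a i)\<^sup>2 = (a' i)\<^sup>2)"
      using Suc.prems(2) by (intro Suc.IH) auto
    then show ?thesis
      using coeffs False by (auto simp: le_Suc_eq less_Suc_eq)
  qed
qed

lemma cfrac_cong:
  assumes "\<And>i. i \<in> {1..k} \<Longrightarrow> b i = b' i" and "\<And>i. i \<in> {1..<k} \<Longrightarrow> a i = a' i"
  shows "cfrac a b k = cfrac a' b' k"
  using assms
proof (induction k)
  case (Suc k)
  then have "cfrac a b k = cfrac a' b' k" by simp
  with Suc.prems show ?case by (cases "k = 0") auto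
qed simp

lemma inverse_cfrac_shift_last:
  "inverse (cfrac a (b(Suc k := b (Suc k) - t)) (Suc k)) = inverse (cfrac a b (Suc k)) + ratconst t"
proof -
  have "cfrac a (b(Suc k := b (Suc k) - t)) k = cfrac a b k"
    by (rule cfrac_cong) auto
  then show ?thesis by (simp add: divide_inverse)
qed

text \<open>This is \<open>(\<phi> + t f) / f = \<phi> / f + t\<close>. The summand
  \<open>smult 0 f\<close> is kept so that the right side matches the formula for
  \<open>F 0\<close>.\<close>

lemma inverse_isofocal:
  assumes "f \<noteq> 0"
  shows "inverse (to_fract f / to_fract (\<phi> + smult t f)) =
    inverse (to_fract f / to_fract (\<phi> + smult 0 f)) + ratconst t"
proof -
  have "to_fract (smult t f) = ratconst t * to_fract f"
    by (simp add: ratconst_def flip: to_fract_mult)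
  then show ?thesis using assms by (simp add: to_fract_add field_simps)
qed

text \<open>Each \<open>g s\<close> is \<open>g t\<close> or \<open>- g t\<close>. These values
  differ, so continuity excludes the second near \<open>t\<close>, and \<open>g\<close> is locally
  constant within \<open>T\<close>, whatever the shape of \<open>T\<close>.\<close>

lemma const_square_has_derivative_zero:
  fixes g :: "'a::real_normed_field \<Rightarrow> 'a"
  assumes "continuous_on T g" and "t \<in> T" and "g t \<noteq> 0"
    and "\<And>s. s \<in> T \<Longrightarrow> (g s)\<^sup>2 = (g t)\<^sup>2"
  shows "(g has_field_derivative 0) (at t within T)"
proof -
  have "(g \<longlongrightarrow> g t) (at t within T)"
    using assms(1,2) by (simp add: continuous_on_def)
  moreover have "g t \<noteq> - g t"
    using assms(3) by (metis add.inverse_unique mult_2 mult_eq_0_iff right_minus zero_neq_numeral)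
  ultimately have "\<forall>\<^sub>F s in at t within T. g s \<noteq> - g t"
    using tendsto_imp_eventually_ne by blast
  moreover have "\<forall>\<^sub>F s in at t within T. s \<in> T"
    by (simp add: eventually_at_filter)
  ultimately have "\<forall>\<^sub>F s in at t within T. g s = g t"
    by eventually_elim (use assms(4) power2_eq_iff in blast)
  moreover have "((\<lambda>s. g t) has_field_derivative 0) (at t within T)"
    by simp
  ultimately show ?thesis
    by (subst has_field_derivative_cong_eventually[where g = "\<lambda>_. g t"]) simp_all
qed

theorem theorem7:
  fixes n :: nat
    and \<alpha>0 m0 :: "nat \<Rightarrow> complex"
    and \<alpha> m :: "nat \<Rightarrow> complex \<Rightarrow> complex"
    and T :: "complex set"
    and F :: "complex \<Rightarrow> complex poly fract"
  assumes "n \<ge> 2"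
    and "inj_on \<alpha>0 {1..n}"
    and "0 \<in> T"
    and "\<And>i. i \<in> {1..n} \<Longrightarrow> \<alpha> i 0 = \<alpha>0 i"
    and "\<And>i. i \<in> {1..n} \<Longrightarrow> m i 0 = m0 i"
    and "\<And>t. t \<in> T \<Longrightarrow> F t = partial_fractions n (\<lambda>i. m i t) (\<lambda>i. \<alpha> i t)"
    and "\<And>t. t \<in> T \<Longrightarrow>
           F t = to_fract (f_poly n m0 \<alpha>0)
                 / to_fract (phi_poly n \<alpha>0 + smult t (f_poly n m0 \<alpha>0))"
    and "\<exists>a0 b0. is_flaschka n (F 0) a0 b0"
  shows "(\<exists>a b. is_flaschka_on T n F a b) \<and>
    (\<forall>a b. is_flaschka_on T n F a b \<longrightarrow>
       (\<forall>t\<in>T.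
          (\<forall>i\<in>{1..n - 1}. (a i has_field_derivative 0) (at t within T)) \<and>
          (\<forall>i\<in>{1..n - 1}. (b i has_field_derivative 0) (at t within T)) \<and>
          (b n has_field_derivative - 1) (at t within T)))"
proof -
  let ?f = "f_poly n m0 \<alpha>0"
  obtain a0 b0 where fl0: "is_flaschka n (F 0) a0 b0"
    using assms(8) by blast
  obtain k where n: "n = Suc k" "k > 0"
    using \<open>n \<ge> 2\<close> by (cases n) auto
  have F0: "F 0 = cfrac a0 b0 n" and a0: "\<And>i. i \<in> {1..<n} \<Longrightarrow> a0 i \<noteq> 0"
    using fl0 n by (auto simp: is_flaschka_def)
  have "F 0 \<noteq> 0"
    using F0 n cfrac_nonzero[of n] by (simp del: cfrac.simps)
  \<comment> \<open>A zero numerator would make \<open>F 0\<close> zero, unlike a continued fraction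
    of positive depth.\<close>
  then have "?f \<noteq> 0"
    using assms(7)[OF \<open>0 \<in> T\<close>] by auto
  have F_shift: "F t = cfrac a0 (b0(n := b0 n - t)) n" if "t \<in> T" for t
  proof -
    have "inverse (F t) = inverse (F 0) + ratconst t"
      unfolding assms(7)[OF that] assms(7)[OF \<open>0 \<in> T\<close>] using \<open>?f \<noteq> 0\<close> by (rule inverse_isofocal)
    also have "\<dots> = inverse (cfrac a0 (b0(n := b0 n - t)) n)"
      unfolding F0 n by (rule inverse_cfrac_shift_last[symmetric])
    finally show ?thesis by simp
  qed
  show ?thesis
  proof (intro conjI allI impI)
    \<comment> \<open>The witnesses are the initial coordinates with only \<open>b0 n\<close> moved;
      constant \<open>a0 i\<close> are trivially continuous.\<close>
    have "is_flaschka_on T n F (\<lambda>i t. a0 i) (\<lambda>i t. (b0(n := b0 n - t)) i)"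
      using F_shift a0 by (auto simp: is_flaschka_on_def is_flaschka_def fun_upd_def)
    then show "\<exists>a b. is_flaschka_on T n F a b" by blast
  next
    fix a b
    assume fl: "is_flaschka_on T n F a b"
    \<comment> \<open>Arbitrary coordinates at time \<open>t\<close> are compared with the explicit
      ones, whose nonvanishing \<open>a0\<close> is what \<open>cfrac_inject\<close> needs.\<close>
    have coords: "(\<forall>i\<in>{1..n}. (b0(n := b0 n - t)) i = b i t) \<and> (\<forall>i\<in>{1..<n}. (a0 i)\<^sup>2 = (a i t)\<^sup>2)"
      if "t \<in> T" for t
    proof (rule cfrac_inject)
      show "cfrac a0 (b0(n := b0 n - t)) n = cfrac (\<lambda>i. a i t) (\<lambda>i. b i t) n"
        using fl that F_shift[OF that] by (auto simp: is_flaschka_on_def is_flaschka_def)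
    qed (rule a0)
    have a_sq: "(a i t)\<^sup>2 = (a0 i)\<^sup>2" if "i \<in> {1..n - 1}" "t \<in> T" for i t
      using coords[OF that(2)] that(1) n by auto
    have b_eq: "b i t = b0 i" if "i \<in> {1..n - 1}" "t \<in> T" for i t
      using coords[OF that(2)] that(1) n by force
    have bn_eq: "b n t = b0 n - t" if "t \<in> T" for t
      using coords[OF that] n by force
    show "\<forall>t\<in>T. (\<forall>i\<in>{1..n - 1}. (a i has_field_derivative 0) (at t within T)) \<and>
        (\<forall>i\<in>{1..n - 1}. (b i has_field_derivative 0) (at t within T)) \<and>
        (b n has_field_derivative - 1) (at t within T)"
    proof (intro ballI conjI)
      fix t i
      assume "t \<in> T" and i: "i \<in> {1..n - 1}"
      show "(a i has_field_derivative 0) (at t within T)"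
      proof (rule const_square_has_derivative_zero)
        show "continuous_on T (a i)" "a i t \<noteq> 0"
          using fl i \<open>t \<in> T\<close> by (auto simp: is_flaschka_on_def is_flaschka_def)
      qed (use a_sq[OF i] \<open>t \<in> T\<close> in auto)
      show "(b i has_field_derivative 0) (at t within T)"
        \<comment> \<open>The equality holds on all of \<open>T\<close>, so radius 1 is an arbitrary
          choice.\<close>
        by (rule has_field_derivative_transform_within[of "\<lambda>_. b0 i", OF _ zero_less_one])
          (simp_all add: b_eq[OF i] \<open>t \<in> T\<close>)
    next
      fix t
      assume "t \<in> T"
      have "((\<lambda>s. b0 n - s) has_field_derivative - 1) (at t within T)"
        by (auto intro!: derivative_eq_intros)
      then show "(b n has_field_derivative - 1) (at t within T)"
        by (rule has_field_derivative_transform_within[OF _ zero_less_one])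
          (simp_all add: bn_eq \<open>t \<in> T\<close>)
    qed
  qed
qed

end
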